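(* For $k>0$ we have the identities $$\zeta(\{2\}^k)=\frac{\pi^{2k}}{(2k+1)!},$$ $$\zeta(\{4\}^k)=\pi^{4k}\sum_{n=0}^{2k}\frac{(-1)^n}{(2n+1)!\,(4k-2n+1)!},$$ $$\zeta(\{8\}^k)=\pi^{8k}\sum_{n=0}^{4k}(-1)^n\left(\sum_{i=0}^{n}\frac{(-1)^i}{(2i+1)!\,(2n-2i+1)!}\right)\left(\sum_{i=0}^{4k-n}\frac{(-1)^i}{(2i+1)!\,(8k-2n-2i+1)!}\right),$$ and increasingly complicated formulas of the shape "$\pi^{2^tk}\times$ finite sum of fractions" can be computed for multiple zeta values of the form $\zeta(\{2^t\}^k)$, $t\in\mathbb Z^+$.
   Context: For $s\in\mathbb C$ with $\operatorname{Re}(s)>1$ and an integer $k\ge1$, the multiple zeta function is $$\zeta(\{s\}^k):=\sum_{\lambda_1>\lambda_2>\cdots>\lambda_k\ge1}\frac{1}{\lambda_1^s\lambda_2^s\cdots\lambda_k^s},$$ the sum being over strictly decreasing $k$-tuples of positive integers. Here $k$ is an integer and $\mathbb Z^+$ is the set of positive integers.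
   Formalization: Signs corrected, as the printed ones fail at k=1: in the identity for ζ({4}^k), (-1)^n becomes (-1)^(n+k); in that for ζ({8}^k), the outer (-1)^n becomes (-1)^(⌊n/2⌋+k). The formulas for general t are given by an explicit finite recursion of rational sums. *)

theory Defs
  imports "HOL-Analysis.Analysis"
begin

definition decreasing_tuples :: "nat \<Rightarrow> nat list set" where
  "decreasing_tuples k = {l. length l = k \<and> sorted_wrt (>) l \<and> (\<forall>x\<in>set l. x \<ge> 1)}"

text \<open>
  The value \<open>\<zeta>({s}^k)\<close>. It is meaningful for \<open>Re s > 1\<close>, where the family is absolutely
  summable; \<^const>\<open>infsum\<close> returns the junk value 0 for families that are not summable.
\<close>
definition mzeta :: "complex \<Rightarrow> nat \<Rightarrow> complex" where
  "mzeta s k = (\<Sum>\<^sub>\<infinity>l\<in>decreasing_tuples k. 1 / (\<Prod>x\<leftarrow>l. of_nat x powr s))"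

text \<open>
  The rational number \<open>\<zeta>({2^t}^k) / \<pi>^(2^t k)\<close>, computed as a finite (iterated) sum of fractions.
  The recursion is obtained by comparing coefficients of \<open>y^(2k)\<close> in
  \<open>\<Prod>m\<ge>1. (1 - y^2/m^(2s)) = (\<Prod>m\<ge>1. (1 - y/m^s)) (\<Prod>m\<ge>1. (1 + y/m^s))\<close>
  with \<open>s = 2^t\<close>, where
  \<open>(\<Prod>m\<ge>1. (1 + y/m^s)) = (\<Sum>k. \<zeta>({s}^k) y^k)\<close>.
  The factor \<open>(-1)^k\<close> is the sign of \<open>y^(2k)\<close> in the left-hand product; it is what makes
  \<open>\<zeta>({4}^1) = \<pi>^4/90\<close> come out positive. The value at \<open>t = 0\<close> is junk.
\<close>
fun mzeta_coeff :: "nat \<Rightarrow> nat \<Rightarrow> rat" where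
  "mzeta_coeff 0 k = 0"
| "mzeta_coeff (Suc 0) k = 1 / fact (2 * k + 1)"
| "mzeta_coeff (Suc (Suc t)) k =
     (\<Sum>n=0..2 * k. (-1) ^ (n + k) * mzeta_coeff (Suc t) n * mzeta_coeff (Suc t) (2 * k - n))"

end

(* The truncated sums over tuples with entries at most N are the coefficients of the finite
   products \<Prod>m\<le>N. (1 + y/m^s), so the recursion from s to 2s is a polynomial
   identity for every N, and it survives the limit. The case s = 2 compares
   \<Sum>k. \<zeta>({2}^k) (-z^2)^k with Euler's product for sin (pi z) / (pi z); the exchange of
   limit and series is dominated convergence, since the k-th coefficient is at most
   (\<Sum>m. 1/m^2)^k. For s = 8 the stated formula is the recursion with vanishing odd terms. *)

theory Submission
  imports Defs
begin

section \<open>Truncated tuple sums as elementary symmetric polynomials\<close>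

text \<open>The generating polynomial of the elementary symmetric polynomials in \<open>f 1\<close>,
  ..., \<open>f N\<close>; the index k of such a polynomial is a degree here.\<close>

abbreviation esym_poly :: "(nat \<Rightarrow> 'a::comm_ring_1) \<Rightarrow> nat \<Rightarrow> 'a poly" where
  "esym_poly f N \<equiv> (\<Prod>m=1..N. [:1, f m:])"

abbreviation bounded_tuples :: "nat \<Rightarrow> nat \<Rightarrow> nat list set" where
  "bounded_tuples N k \<equiv> {l \<in> decreasing_tuples k. set l \<subseteq> {..N}}"

lemma esym_poly_Suc: "esym_poly f (Suc N) = esym_poly f N + pCons 0 (smult (f (Suc N)) (esym_poly f N))"
  by (simp add: mult.commute)

lemma coeff_esym_poly_0 [simp]: "coeff (esym_poly f N) 0 = 1"
  by (induction N) (simp_all only: esym_poly_Suc, simp_all)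

lemma coeff_esym_poly_Suc:
  "coeff (esym_poly f (Suc N)) (Suc k) =
     coeff (esym_poly f N) (Suc k) + f (Suc N) * coeff (esym_poly f N) k"
  by (simp only: esym_poly_Suc) simp

lemma finite_bounded_tuples: "finite (bounded_tuples N k)"
  by (rule finite_subset[OF _ finite_lists_length_eq[of "{..N}" k]])
     (auto simp: decreasing_tuples_def)

lemma bounded_tuples_0: "bounded_tuples N 0 = {[]}"
  by (auto simp: decreasing_tuples_def)

lemma bounded_tuples_0_Suc: "bounded_tuples 0 (Suc k) = {}"
  by (fastforce simp: decreasing_tuples_def length_Suc_conv)

text \<open>Entries strictly decrease, so \<open>Suc N\<close> can occur only as the head. Splitting
  by whether it occurs gives the recurrence of \<open>coeff_esym_poly_Suc\<close>.\<close>

lemma bounded_tuples_Suc: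
  "bounded_tuples (Suc N) (Suc k) =
     bounded_tuples N (Suc k) \<union> Cons (Suc N) ` bounded_tuples N k" (is "?L = ?R")
proof (intro equalityI subsetI)
  fix l assume l: "l \<in> ?L"
  then obtain x xs where x: "l = x # xs"
    by (cases l) (auto simp: decreasing_tuples_def)
  show "l \<in> ?R"
  proof (cases "x = Suc N")
    case True
    with l x have "xs \<in> bounded_tuples N k"
      by (auto simp: decreasing_tuples_def)
    with x True show ?thesis by auto
  next
    case False
    with l x have "l \<in> bounded_tuples N (Suc k)"
      by (fastforce simp: decreasing_tuples_def)
    then show ?thesis by blast
  qed
next
  fix l assume "l \<in> ?R"
  then show "l \<in> ?L"
    by (fastforce simp: decreasing_tuples_def)
qed

lemma sum_bounded_tuples:
  "(\<Sum>l\<in>bounded_tuples N k. prod_list (map f l)) = coeff (esym_poly f N) k"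
proof (induction N arbitrary: k)
  case 0
  show ?case
    by (cases k) (simp_all only: bounded_tuples_0 bounded_tuples_0_Suc, simp_all)
next
  case (Suc N)
  show ?case
  proof (cases k)
    case 0
    then show ?thesis
      by (simp only: bounded_tuples_0 coeff_esym_poly_0) simp
  next
    case k: (Suc j)
    have "bounded_tuples N (Suc j) \<inter> Cons (Suc N) ` bounded_tuples N j = {}"
      by auto
    then have "(\<Sum>l\<in>bounded_tuples (Suc N) (Suc j). prod_list (map f l)) =
        (\<Sum>l\<in>bounded_tuples N (Suc j). prod_list (map f l)) +
        (\<Sum>l\<in>Cons (Suc N) ` bounded_tuples N j. prod_list (map f l))"
      by (simp only: bounded_tuples_Suc)
         (intro sum.union_disjoint finite_imageI finite_bounded_tuples)
    also have "(\<Sum>l\<in>Cons (Suc N) ` bounded_tuples N j. prod_list (map f l)) =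
        f (Suc N) * (\<Sum>l\<in>bounded_tuples N j. prod_list (map f l))"
      by (subst sum.reindex) (simp_all add: sum_distrib_left)
    finally show ?thesis
      by (simp only: k Suc.IH coeff_esym_poly_Suc)
  qed
qed

section \<open>Uniform bounds and the limit of the truncated sums\<close>

text \<open>Each product over k distinct indices already occurs in the expansion of the k-th power.
  The bound becomes uniform in N once the partial sums of f are bounded, and serves as the majorant
  in all limits below.\<close>

lemma coeff_esym_poly_le:
  fixes f :: "nat \<Rightarrow> real"
  assumes f: "\<And>m. f m \<ge> 0"
  shows "coeff (esym_poly f N) k \<le> (\<Sum>m=1..N. f m) ^ k"
proof (induction N arbitrary: k)
  case 0
  show ?case by (cases k) auto
next
  case (Suc N)
  let ?S = "\<Sum>m=1..N. f m"
  have S: "?S \<ge> 0" by (intro sum_nonneg f)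
  show ?case
  proof (cases k)
    case 0
    then show ?thesis by (simp only: coeff_esym_poly_0) simp
  next
    case k: (Suc j)
    have "coeff (esym_poly f (Suc N)) (Suc j) \<le> ?S ^ Suc j + f (Suc N) * ?S ^ j"
      unfolding coeff_esym_poly_Suc by (intro add_mono mult_left_mono Suc.IH f)
    also have "\<dots> = (?S + f (Suc N)) * ?S ^ j"
      by (simp add: algebra_simps)
    also have "\<dots> \<le> (?S + f (Suc N)) * (?S + f (Suc N)) ^ j"
      using S f[of "Suc N"] by (intro mult_left_mono power_mono) auto
    finally show ?thesis by (simp add: k)
  qed
qed

lemma norm_prod_list: "norm (prod_list xs) = prod_list (map norm (xs :: 'a::real_normed_field list))"
  by (induction xs) (auto simp: norm_mult)

lemma sum_norm_bounded_tuples_le: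
  fixes f :: "nat \<Rightarrow> 'a::real_normed_field"
  assumes "\<And>N. (\<Sum>m=1..N. norm (f m)) \<le> C"
  shows "(\<Sum>l\<in>bounded_tuples N k. norm (prod_list (map f l))) \<le> C ^ k"
proof -
  have "(\<Sum>l\<in>bounded_tuples N k. norm (prod_list (map f l))) =
      coeff (esym_poly (\<lambda>m. norm (f m)) N) k"
    unfolding sum_bounded_tuples[symmetric] by (simp add: norm_prod_list o_def)
  also have "\<dots> \<le> (\<Sum>m=1..N. norm (f m)) ^ k"
    by (rule coeff_esym_poly_le) simp
  also have "\<dots> \<le> C ^ k"
    by (intro power_mono assms sum_nonneg) simp
  finally show ?thesis .
qed

lemma norm_coeff_esym_poly_le:
  fixes f :: "nat \<Rightarrow> 'a::real_normed_field"
  assumes "\<And>N. (\<Sum>m=1..N. norm (f m)) \<le> C"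
  shows "norm (coeff (esym_poly f N) k) \<le> C ^ k"
  unfolding sum_bounded_tuples[symmetric]
  by (rule order_trans[OF norm_sum sum_norm_bounded_tuples_le[OF assms]])

text \<open>The uniform bound gives absolute summability over all tuples. The sets
  \<open>bounded_tuples N k\<close> are cofinal among the finite sets of tuples, so the unordered
  sum is the limit along N.\<close>

lemma coeff_esym_poly_tendsto:
  fixes f :: "nat \<Rightarrow> complex"
  assumes C: "\<And>N. (\<Sum>m=1..N. norm (f m)) \<le> C"
  shows "(\<lambda>N. coeff (esym_poly f N) k) \<longlonglongrightarrow>
           (\<Sum>\<^sub>\<infinity>l\<in>decreasing_tuples k. prod_list (map f l))"
proof -
  \<comment> \<open>Used twice: to bound the norm sums over arbitrary finite sets, and for
    cofinality.\<close>
  have ex: "\<exists>M. X \<subseteq> bounded_tuples M k"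
    if "finite X" "X \<subseteq> decreasing_tuples k" for X
  proof -
    have "finite (\<Union>(set ` X))" using that by auto
    then obtain M where "\<Union>(set ` X) \<subseteq> {..M}"
      using finite_nat_set_iff_bounded_le[of "\<Union>(set ` X)"] by auto
    then show ?thesis using that by blast
  qed
  have "bdd_above (sum (\<lambda>l. norm (prod_list (map f l))) ` {F. F \<subseteq> decreasing_tuples k \<and> finite F})"
  proof (rule bdd_aboveI2)
    fix X assume "X \<in> {F. F \<subseteq> decreasing_tuples k \<and> finite F}"
    then obtain M where "X \<subseteq> bounded_tuples M k" using ex by blast
    then have "(\<Sum>l\<in>X. norm (prod_list (map f l))) \<le>
        (\<Sum>l\<in>bounded_tuples M k. norm (prod_list (map f l)))"
      by (intro sum_mono2 finite_bounded_tuples) auto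
    also have "\<dots> \<le> C ^ k"
      by (rule sum_norm_bounded_tuples_le[OF C])
    finally show "(\<Sum>l\<in>X. norm (prod_list (map f l))) \<le> C ^ k" .
  qed
  then have "(\<lambda>l. prod_list (map f l)) summable_on decreasing_tuples k"
    by (rule abs_summable_summable[OF abs_summable_iff_bdd_above[THEN iffD2]])
  then have "((\<lambda>l. prod_list (map f l)) has_sum
      (\<Sum>\<^sub>\<infinity>l\<in>decreasing_tuples k. prod_list (map f l))) (decreasing_tuples k)"
    by (rule has_sum_infsum)
  moreover have "filterlim (\<lambda>N. bounded_tuples N k) (finite_subsets_at_top (decreasing_tuples k)) sequentially"
    unfolding filterlim_finite_subsets_at_top
  proof safe
    fix X assume "finite X" "X \<subseteq> decreasing_tuples k"
    then obtain M where M: "X \<subseteq> bounded_tuples M k" using ex by blast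
    show "\<forall>\<^sub>F N in sequentially. finite (bounded_tuples N k) \<and> X \<subseteq> bounded_tuples N k \<and>
        bounded_tuples N k \<subseteq> decreasing_tuples k"
      using eventually_ge_at_top[of M]
    proof eventually_elim
      case (elim N)
      then have "bounded_tuples M k \<subseteq> bounded_tuples N k" by auto
      with M finite_bounded_tuples show ?case by auto
    qed
  qed
  ultimately have "(\<lambda>N. \<Sum>l\<in>bounded_tuples N k. prod_list (map f l)) \<longlonglongrightarrow>
      (\<Sum>\<^sub>\<infinity>l\<in>decreasing_tuples k. prod_list (map f l))"
    unfolding has_sum_def by (rule filterlim_compose)
  then show ?thesis by (simp only: sum_bounded_tuples)
qed

section \<open>The doubling identity, first for polynomials and then for zeta values\<close>

lemma coeff_pcompose_square:
  "coeff (pcompose p [:0, 0, 1:]) (2 * k) = coeff (p :: 'a::comm_ring_1 poly) k"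
proof (induction p arbitrary: k)
  case (pCons a p)
  show ?case
    by (cases k) (simp_all add: pcompose_pCons pCons.IH)
qed simp

text \<open>Comparison of the coefficients of \<open>y^(2k)\<close> in
  \<open>\<Prod>(1 - f m ^ 2 y^2) = \<Prod>(1 - f m y) \<Prod>(1 + f m y)\<close>.\<close>
lemma coeff_esym_poly_square:
  "coeff (esym_poly (\<lambda>m. f m ^ 2) N) k =
     (\<Sum>n=0..2 * k. (-1) ^ (n + k) * coeff (esym_poly f N) n * coeff (esym_poly f N) (2 * k - n))"
proof -
  \<comment> \<open>Composing with \<open>[:0, -1:]\<close> replaces y by -y, and composing with
    \<open>[:0, 0, 1:]\<close> then replaces y by y^2. Each factor on the left becomes 1 - (f m)^2
    y^2, a difference of squares.\<close>
  have "pcompose (esym_poly (\<lambda>m. f m ^ 2) N) [:0, -1:] \<circ>\<^sub>p [:0, 0, 1:] =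
      pcompose (esym_poly f N) [:0, -1:] * esym_poly f N"
    unfolding pcompose_prod prod.distrib[symmetric]
    by (intro prod.cong refl) (simp add: pcompose_pCons power2_eq_square)
  then have "(-1) ^ k * coeff (esym_poly (\<lambda>m. f m ^ 2) N) k =
      coeff (pcompose (esym_poly f N) [:0, -1:] * esym_poly f N) (2 * k)"
    by (metis coeff_pcompose_linear coeff_pcompose_square)
  also have "\<dots> = (\<Sum>n=0..2 * k. (-1) ^ n * coeff (esym_poly f N) n * coeff (esym_poly f N) (2 * k - n))"
    by (simp add: coeff_mult coeff_pcompose_linear atLeast0AtMost)
  \<comment> \<open>A second factor (-1)^k cancels the sign on the left and puts it into the
    summands on the right.\<close>
  finally have "(-1) ^ k * ((-1) ^ k * coeff (esym_poly (\<lambda>m. f m ^ 2) N) k) =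
     (-1) ^ k * (\<Sum>n=0..2 * k. (-1) ^ n * coeff (esym_poly f N) n * coeff (esym_poly f N) (2 * k - n))"
    by (rule arg_cong)
  moreover have "(-1) ^ k * ((-1) ^ k * a) = a" for a :: 'a
    by (simp flip: mult.assoc power_mult_distrib)
  ultimately show ?thesis
    by (simp add: sum_distrib_left power_add mult_ac)
qed

lemma sum_inverse_power_bounded:
  assumes "s \<ge> 2"
  shows "\<exists>C. \<forall>N. (\<Sum>m=1..N. norm (1 / of_nat m ^ s :: complex)) \<le> C"
proof (intro exI allI)
  fix N
  have "summable (\<lambda>m. norm (1 / of_nat m ^ s :: complex))"
    using inverse_power_summable[OF assms, where ?'a = real]
    by (simp add: norm_divide norm_power inverse_eq_divide)
  then show "(\<Sum>m=1..N. norm (1 / of_nat m ^ s :: complex)) \<le> (\<Sum>m. norm (1 / of_nat m ^ s :: complex))"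
    by (intro sum_le_suminf) auto
qed

lemma mzeta_of_nat_eq:
  assumes "s > 0"
  shows "mzeta (of_nat s) k = (\<Sum>\<^sub>\<infinity>l\<in>decreasing_tuples k. prod_list (map (\<lambda>m. 1 / of_nat m ^ s) l))"
  unfolding mzeta_def
proof (intro infsum_cong)
  fix l assume "l \<in> decreasing_tuples k"
  then have "\<forall>x\<in>set l. x \<ge> 1" by (simp add: decreasing_tuples_def)
  then have "prod_list (map (\<lambda>m. 1 / of_nat m ^ s :: complex) l) = 1 / (\<Prod>x\<leftarrow>l. of_nat x powr of_nat s)"
    by (induction l) (auto simp: powr_nat' assms mult.commute)
  then show "1 / (\<Prod>x\<leftarrow>l. of_nat x powr of_nat s) = prod_list (map (\<lambda>m. 1 / of_nat m ^ s :: complex) l)"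
    by simp
qed

lemma coeff_esym_poly_tendsto_mzeta:
  assumes "s \<ge> 2"
  shows "(\<lambda>N. coeff (esym_poly (\<lambda>m. 1 / of_nat m ^ s) N) k) \<longlonglongrightarrow> mzeta (of_nat s) k"
proof -
  obtain C where "\<And>N. (\<Sum>m=1..N. norm (1 / of_nat m ^ s :: complex)) \<le> C"
    using sum_inverse_power_bounded[OF assms] by blast
  from coeff_esym_poly_tendsto[OF this] show ?thesis
    using assms by (subst mzeta_of_nat_eq) auto
qed

text \<open>As 1/m^(2s) is the square of 1/m^s, the polynomial identity holds for every N. Its
  right-hand side has a number of terms independent of N, so the limit may be taken term by
  term.\<close>

lemma mzeta_double:
  assumes "s \<ge> 2"
  shows "mzeta (of_nat (2 * s)) k =
    (\<Sum>n=0..2 * k. (-1) ^ (n + k) * mzeta (of_nat s) n * mzeta (of_nat s) (2 * k - n))"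
proof (rule LIMSEQ_unique)
  show "(\<lambda>N. coeff (esym_poly (\<lambda>m. (1 / of_nat m ^ s) ^ 2 :: complex) N) k) \<longlonglongrightarrow> mzeta (of_nat (2 * s)) k"
    using coeff_esym_poly_tendsto_mzeta[of "2 * s" k] assms
    by (simp add: power_divide mult.commute flip: power_mult)
  show "(\<lambda>N. coeff (esym_poly (\<lambda>m. (1 / of_nat m ^ s) ^ 2 :: complex) N) k) \<longlonglongrightarrow>
      (\<Sum>n=0..2 * k. (-1) ^ (n + k) * mzeta (of_nat s) n * mzeta (of_nat s) (2 * k - n))"
    unfolding coeff_esym_poly_square
    by (intro tendsto_sum tendsto_mult tendsto_const coeff_esym_poly_tendsto_mzeta assms)
qed

section \<open>The case s = 2 from Euler's sine product\<close>

lemma poly_eq_suminf: "poly p (x :: complex) = (\<Sum>k. coeff p k * x ^ k)"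
  unfolding poly_altdef
  by (intro sums_unique sums_finite) (auto simp: coeff_eq_0)

text \<open>Tannery's theorem: the k-th term is dominated, uniformly in N, by the k-th term of the
  geometric series with ratio \<open>C * norm y\<close>.\<close>

lemma suminf_mzeta_2:
  assumes C: "\<And>N. (\<Sum>m=1..N. norm (1 / of_nat m ^ 2 :: complex)) \<le> C"
    and y: "C * norm y < 1"
  shows "summable (\<lambda>k. mzeta 2 k * y ^ k)"
    and "(\<lambda>N. \<Prod>m=1..N. 1 + y / of_nat m ^ 2) \<longlonglongrightarrow> (\<Sum>k. mzeta 2 k * y ^ k)"
proof -
  let ?e = "\<lambda>k N. coeff (esym_poly (\<lambda>m. 1 / of_nat m ^ 2 :: complex) N) k"
  have C0: "C \<ge> 0" using C[of 0] by simp
  have lim: "?e k \<longlonglongrightarrow> mzeta 2 k" for k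
    using coeff_esym_poly_tendsto_mzeta[of 2 k] by simp
  have "norm (?e k N * y ^ k) \<le> (C * norm y) ^ k" for k N
    unfolding norm_mult norm_power power_mult_distrib
    by (intro mult_right_mono norm_coeff_esym_poly_le C) auto
  then have bound: "\<forall>\<^sub>F (k, N) in at_top \<times>\<^sub>F sequentially. norm (?e k N * y ^ k) \<le> (C * norm y) ^ k"
    by (intro always_eventually) auto
  have summ: "summable (\<lambda>k. (C * norm y) ^ k)"
    using y C0 by (intro summable_geometric) (simp add: abs_mult)
  have "summable (\<lambda>k. norm (mzeta 2 k * y ^ k)) \<and>
      (\<lambda>N. \<Sum>k. ?e k N * y ^ k) \<longlonglongrightarrow> (\<Sum>k. mzeta 2 k * y ^ k)"
    using tannerys_theorem[of "\<lambda>k N. ?e k N * y ^ k", OF tendsto_mult[OF lim tendsto_const] bound summ]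
    by simp
  moreover have "(\<Sum>k. ?e k N * y ^ k) = (\<Prod>m=1..N. 1 + y / of_nat m ^ 2)" for N
    unfolding poly_eq_suminf[symmetric] by (simp add: poly_prod)
  ultimately show "summable (\<lambda>k. mzeta 2 k * y ^ k)"
    and "(\<lambda>N. \<Prod>m=1..N. 1 + y / of_nat m ^ 2) \<longlonglongrightarrow> (\<Sum>k. mzeta 2 k * y ^ k)"
    by (auto intro: summable_norm_cancel)
qed

text \<open>The alternating sign of the sine series is absorbed into the power of -z^2, which makes
  this a power series in y = -z^2, the variable of the product of 1 + y/m^2.\<close>

lemma sinc_sums:
  fixes z :: complex
  assumes "z \<noteq> 0"
  shows "(\<lambda>n. of_real pi ^ (2 * n) / fact (2 * n + 1) * (- (z ^ 2)) ^ n) sums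
           (sin (of_real pi * z) / (of_real pi * z))"
proof -
  let ?w = "of_real pi * z"
  have "strict_mono (\<lambda>n::nat. 2 * n + 1)" by (simp add: strict_mono_def)
  moreover have "sin_coeff n *\<^sub>R ?w ^ n = 0" if "n \<notin> range (\<lambda>n. 2 * n + 1)" for n
    using that by (auto simp: sin_coeff_def elim!: oddE)
  ultimately have "(\<lambda>n. sin_coeff (2 * n + 1) *\<^sub>R ?w ^ (2 * n + 1)) sums sin ?w"
    using sin_converges[of ?w] by (subst sums_mono_reindex) auto
  then have "(\<lambda>n. sin_coeff (2 * n + 1) *\<^sub>R ?w ^ (2 * n + 1) / ?w) sums (sin ?w / ?w)"
    by (rule sums_divide)
  moreover have "sin_coeff (2 * n + 1) *\<^sub>R ?w ^ (2 * n + 1) / ?w =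
      of_real pi ^ (2 * n) / fact (2 * n + 1) * (- (z ^ 2)) ^ n" for n
  proof -
    have "(- (z ^ 2)) ^ n = (-1) ^ n * z ^ (2 * n)"
      by (simp add: power_mult flip: power_mult_distrib)
    then show ?thesis
      using assms by (simp add: sin_coeff_def scaleR_conv_of_real power_mult_distrib del: fact_Suc)
  qed
  ultimately show ?thesis by (simp only:)
qed

text \<open>Two power series with positive radius of convergence that agree near 0 have equal
  coefficients.\<close>

lemma mzeta_2: "mzeta 2 k = of_real pi ^ (2 * k) / fact (2 * k + 1)"
proof -
  obtain C where C: "\<And>N. (\<Sum>m=1..N. norm (1 / of_nat m ^ 2 :: complex)) \<le> C"
    using sum_inverse_power_bounded[of 2] by auto
  \<comment> \<open>The term for m = 1 is 1.\<close>
  have C1: "C \<ge> 1" using C[of 1] by simp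
  define d where "d = (\<lambda>n. of_real pi ^ (2 * n) / fact (2 * n + 1) :: complex)"
  have "Abs_fps (mzeta 2) = Abs_fps d"
  proof (rule eval_fps_eqD)
    \<comment> \<open>A nonzero point with \<open>C * norm w\<close> = 1/2 < 1, where the zeta
      series converges; so its radius is positive.\<close>
    define w :: complex where "w = of_real (1 / (2 * C))"
    have w: "norm w = 1 / (2 * C)"
      using C1 unfolding w_def norm_of_real by simp
    then have "0 < ereal (norm w)" using C1 by simp
    also have "\<dots> \<le> conv_radius (mzeta 2)"
      by (rule conv_radius_geI, rule suminf_mzeta_2(1)[OF C]) (use C1 w in auto)
    finally show "fps_conv_radius (Abs_fps (mzeta 2)) > 0"
      by (simp add: fps_conv_radius_def)
    \<comment> \<open>At z = \<i> the variable -z^2 equals 1.\<close>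
    have "summable (\<lambda>n. d n * 1 ^ n)"
      using sinc_sums[of \<i>] by (auto simp: d_def sums_iff)
    from conv_radius_geI[OF this] have "ereal 1 \<le> conv_radius d" by simp
    then show "fps_conv_radius (Abs_fps d) > 0"
      by (auto simp: fps_conv_radius_def intro: less_le_trans[of _ "ereal 1"])
    have "\<forall>\<^sub>F y in nhds 0. y \<in> ball (0::complex) (1 / C)"
      using C1 by (intro eventually_nhds_in_open) auto
    then show "\<forall>\<^sub>F y in nhds 0. eval_fps (Abs_fps (mzeta 2)) y = eval_fps (Abs_fps d) y"
    proof eventually_elim
      case (elim y)
      then have y: "C * norm y < 1" using C1 by (simp add: field_simps)
      show ?case
      \<comment> \<open>The quotient sin(pi z)/(pi z) has no direct meaning at z = 0. There both
        constant terms are 1, on the zeta side from the empty tuple.\<close>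
      proof (cases "y = 0")
        case True
        have "decreasing_tuples 0 = {[]}"
          by (auto simp: decreasing_tuples_def)
        then have "mzeta 2 0 = 1"
          by (simp add: mzeta_def)
        with True show ?thesis by (simp add: eval_fps_at_0 d_def)
      next
        case False
        \<comment> \<open>With z^2 = -y the factor 1 + y/m^2 is Euler's factor 1 - z^2/m^2.\<close>
        define z where "z = csqrt (- y)"
        have z: "z \<noteq> 0" "y = - (z ^ 2)" using False by (auto simp: z_def)
        have "(\<lambda>N. of_real pi * z * (\<Prod>m=1..N. 1 + y / of_nat m ^ 2)) \<longlonglongrightarrow> sin (of_real pi * z)"
          using sin_product_formula_complex[of z] by (simp add: z)
        moreover have "(\<lambda>N. of_real pi * z * (\<Prod>m=1..N. 1 + y / of_nat m ^ 2)) \<longlonglongrightarrow>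
            of_real pi * z * (\<Sum>k. mzeta 2 k * y ^ k)"
          by (intro tendsto_mult tendsto_const suminf_mzeta_2(2)[OF C y])
        ultimately have "sin (of_real pi * z) = of_real pi * z * (\<Sum>k. mzeta 2 k * y ^ k)"
          by (rule LIMSEQ_unique)
        moreover have "(\<Sum>k. d k * y ^ k) = sin (of_real pi * z) / (of_real pi * z)"
          unfolding d_def z(2) using sinc_sums[OF z(1)] by (simp only: sums_iff)
        ultimately show ?thesis using z(1) by (simp add: eval_fps_def)
      qed
    qed
  qed
  then show ?thesis
    by (metis d_def fps_nth_Abs_fps)
qed

section \<open>Exponents that are powers of two\<close>

lemma of_rat_fact: "of_rat (fact n) = fact n"
  by (metis of_nat_fact of_rat_of_nat_eq)

text \<open>Induction on t by doubling. In every summand the two powers of pi have exponents adding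
  up to 2^(t+1) k, so pi factors out and the recursion of \<open>mzeta_coeff\<close>
  remains.\<close>

lemma mzeta_power_2:
  assumes "t \<ge> 1"
  shows "mzeta (2 ^ t) k = of_real pi ^ (2 ^ t * k) * of_rat (mzeta_coeff t k)"
  using assms
proof (induction t arbitrary: k rule: dec_induct)
  case base
  then show ?case by (simp add: mzeta_2 of_rat_divide of_rat_fact del: fact_Suc)
next
  case (step t)
  obtain u where u: "t = Suc u" using step.hyps by (cases t) auto
  have "mzeta (2 ^ Suc t) k =
      (\<Sum>n=0..2 * k. (-1) ^ (n + k) * mzeta (2 ^ t) n * mzeta (2 ^ t) (2 * k - n))"
    using mzeta_double[of "2 ^ t" k] u by simp
  also have "\<dots> = (\<Sum>n=0..2 * k. of_real pi ^ (2 ^ Suc t * k) *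
      of_rat ((-1) ^ (n + k) * mzeta_coeff t n * mzeta_coeff t (2 * k - n)))"
  proof (intro sum.cong refl)
    fix n assume "n \<in> {0..2 * k}"
    then have "2 ^ t * n + 2 ^ t * (2 * k - n) = 2 ^ Suc t * k"
      by (simp flip: distrib_left)
    then have "(of_real pi :: complex) ^ (2 ^ t * n) * of_real pi ^ (2 ^ t * (2 * k - n)) =
        of_real pi ^ (2 ^ Suc t * k)"
      by (simp only: flip: power_add)
    then show "(-1) ^ (n + k) * mzeta (2 ^ t) n * mzeta (2 ^ t) (2 * k - n) =
        of_real pi ^ (2 ^ Suc t * k) *
        of_rat ((-1) ^ (n + k) * mzeta_coeff t n * mzeta_coeff t (2 * k - n))"
      unfolding step.IH by (simp add: of_rat_mult of_rat_power mult_ac)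
  qed
  also have "\<dots> = of_real pi ^ (2 ^ Suc t * k) * of_rat (mzeta_coeff (Suc t) k)"
    by (simp only: u mzeta_coeff.simps of_rat_sum sum_distrib_left)
  finally show ?case .
qed

section \<open>Closed forms for the exponents 4 and 8\<close>

lemma mzeta_coeff_2:
  "mzeta_coeff 2 k = (\<Sum>n=0..2 * k. (-1) ^ (n + k) / (fact (2 * n + 1) * fact (4 * k - 2 * n + 1)))"
proof -
  have "mzeta_coeff 2 k = (\<Sum>n=0..2 * k. (-1) ^ (n + k) * (1 / fact (2 * n + 1)) * (1 / fact (2 * (2 * k - n) + 1)))"
    by (simp add: numeral_2_eq_2)
  also have "\<dots> = (\<Sum>n=0..2 * k. (-1) ^ (n + k) / (fact (2 * n + 1) * fact (4 * k - 2 * n + 1)))"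
    by (simp add: diff_mult_distrib2)
  finally show ?thesis .
qed

text \<open>The coefficient of x^(2n) in (sin x / x)(sinh x / x). The type is left general because
  the sum is needed both over the rationals and over the complex numbers.\<close>

definition signed_fact_sum :: "nat \<Rightarrow> 'a::field_char_0" where
  "signed_fact_sum n = (\<Sum>i=0..n. (-1) ^ i / (fact (2 * i + 1) * fact (2 * n - 2 * i + 1)))"

lemma signed_fact_sum_even: "signed_fact_sum (2 * k) = (-1) ^ k * mzeta_coeff 2 k"
  unfolding signed_fact_sum_def mzeta_coeff_2 sum_distrib_left
  by (intro sum.cong refl) (simp add: power_add flip: mult.assoc power_mult_distrib)

text \<open>Reversing the summation by i -> n - i swaps the two factorials and, for odd n, flips the
  sign. The sum thus equals its own negative.\<close>

lemma signed_fact_sum_odd: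
  assumes "odd n"
  shows "signed_fact_sum n = (0 :: 'a::field_char_0)"
proof -
  let ?g = "\<lambda>i. (-1) ^ i / (fact (2 * i + 1) * fact (2 * n - 2 * i + 1)) :: 'a"
  have "sum ?g {0..n} = (\<Sum>i=0..n. ?g (n + 0 - i))"
    by (rule sum.atLeastAtMost_rev)
  also have "\<dots> = (\<Sum>i=0..n. - ?g i)"
  proof (intro sum.cong refl)
    fix i assume i: "i \<in> {0..n}"
    then have "2 * n - 2 * (n - i) = 2 * i" "2 * (n - i) = 2 * n - 2 * i" by auto
    moreover have "(-1 :: 'a) ^ (n - i) = - ((-1) ^ i)"
      using assms i by (auto simp: minus_one_power_iff)
    ultimately show "?g (n + 0 - i) = - ?g i"
      by (simp only: add_0_right) simp
  qed
  finally show ?thesis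
    by (simp add: signed_fact_sum_def sum_negf equation_minus_iff)
qed

lemma of_rat_signed_fact_sum: "of_rat (signed_fact_sum n) = (signed_fact_sum n :: 'a::field_char_0)"
  by (simp add: signed_fact_sum_def of_rat_sum of_rat_divide of_rat_mult of_rat_power of_rat_minus of_rat_fact del: fact_Suc)

text \<open>Only even n = 2m contribute, and there \<open>n div 2\<close> is m. The signs (-1)^m and
  (-1)^(2k-m) of the two inner sums cancel, leaving the recursion from 4 to 8 with its sign
  (-1)^(m+k).\<close>

lemma mzeta_coeff_3:
  "mzeta_coeff 3 k =
     (\<Sum>n=0..4 * k. (-1) ^ (n div 2 + k) * signed_fact_sum n * signed_fact_sum (4 * k - n))"
proof -
  let ?h = "\<lambda>n. (-1) ^ (n div 2 + k) * signed_fact_sum n * signed_fact_sum (4 * k - n) :: rat"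
  have "sum ?h {0..4 * k} = sum ?h ((*) 2 ` {0..2 * k})"
  proof (rule sum.mono_neutral_right)
    show "\<forall>n\<in>{0..4 * k} - (*) 2 ` {0..2 * k}. ?h n = 0"
    proof
      fix n assume "n \<in> {0..4 * k} - (*) 2 ` {0..2 * k}"
      then have "odd n" by (auto elim!: evenE)
      then show "?h n = 0" by (simp add: signed_fact_sum_odd)
    qed
  qed auto
  also have "\<dots> = (\<Sum>n=0..2 * k. ?h (2 * n))"
    by (subst sum.reindex) (auto simp: inj_on_def)
  also have "\<dots> = (\<Sum>n=0..2 * k. (-1) ^ (n + k) * mzeta_coeff 2 n * mzeta_coeff 2 (2 * k - n))"
  proof (intro sum.cong refl)
    fix n assume n: "n \<in> {0..2 * k}"
    then have "4 * k - 2 * n = 2 * (2 * k - n)" by simp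
    moreover have "(-1 :: rat) ^ n * (-1) ^ (2 * k - n) = 1"
      using n by (simp flip: power_add)
    moreover have "?h (2 * n) = (-1) ^ (n + k) * ((-1) ^ n * (-1) ^ (2 * k - n)) *
        mzeta_coeff 2 n * mzeta_coeff 2 (2 * k - n)"
      by (simp only: calculation(1) signed_fact_sum_even) simp
    ultimately show "?h (2 * n) = (-1) ^ (n + k) * mzeta_coeff 2 n * mzeta_coeff 2 (2 * k - n)"
      by simp
  qed
  also have "\<dots> = mzeta_coeff 3 k"
    by (simp add: numeral_3_eq_3 numeral_2_eq_2)
  finally show ?thesis by simp
qed

text \<open>The signs are those that the doubling recursion produces. For s = 4 and k = 1 the sum
  with sign (-1)^n alone would be -1/90, so the factor (-1)^k matters. For s = 8 the surviving terms
  have even n and alternate in n/2, hence the exponent \<open>n div 2 + k\<close>.\<close>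

theorem corollary2p11:
  fixes k :: nat
  assumes "k > 0"
  shows
    "mzeta 2 k = of_real pi ^ (2 * k) / fact (2 * k + 1)
   \<and> mzeta 4 k = of_real pi ^ (4 * k) *
       (\<Sum>n=0..2 * k. (-1) ^ (n + k) / (fact (2 * n + 1) * fact (4 * k - 2 * n + 1)))
   \<and> mzeta 8 k = of_real pi ^ (8 * k) *
       (\<Sum>n=0..4 * k. (-1) ^ (n div 2 + k) *
          (\<Sum>i=0..n. (-1) ^ i / (fact (2 * i + 1) * fact (2 * n - 2 * i + 1))) *
          (\<Sum>i=0..4 * k - n. (-1) ^ i / (fact (2 * i + 1) * fact (8 * k - 2 * n - 2 * i + 1))))
   \<and> (\<forall>t\<ge>1. mzeta (2 ^ t) k = of_real pi ^ (2 ^ t * k) * of_rat (mzeta_coeff t k))"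
proof (intro conjI allI impI)
  show "mzeta 2 k = of_real pi ^ (2 * k) / fact (2 * k + 1)"
    by (rule mzeta_2)
  show "mzeta 4 k = of_real pi ^ (4 * k) *
       (\<Sum>n=0..2 * k. (-1) ^ (n + k) / (fact (2 * n + 1) * fact (4 * k - 2 * n + 1)))"
    using mzeta_power_2[of 2 k]
    by (simp add: mzeta_coeff_2 of_rat_sum of_rat_divide of_rat_mult of_rat_power of_rat_minus of_rat_fact del: fact_Suc)
  \<comment> \<open>Doubling distributes over truncated subtraction, so this holds for every n, even
    beyond 4k.\<close>
  have "(signed_fact_sum (4 * k - n) :: complex) =
      (\<Sum>i=0..4 * k - n. (-1) ^ i / (fact (2 * i + 1) * fact (8 * k - 2 * n - 2 * i + 1)))" for n
    by (simp add: signed_fact_sum_def diff_mult_distrib2)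
  then show "mzeta 8 k = of_real pi ^ (8 * k) *
       (\<Sum>n=0..4 * k. (-1) ^ (n div 2 + k) *
          (\<Sum>i=0..n. (-1) ^ i / (fact (2 * i + 1) * fact (2 * n - 2 * i + 1))) *
          (\<Sum>i=0..4 * k - n. (-1) ^ i / (fact (2 * i + 1) * fact (8 * k - 2 * n - 2 * i + 1))))"
    using mzeta_power_2[of 3 k] unfolding signed_fact_sum_def[symmetric]
    by (simp add: mzeta_coeff_3 of_rat_sum of_rat_mult of_rat_power of_rat_minus
        of_rat_signed_fact_sum)
qed (rule mzeta_power_2)

end
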